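(* Let $q$ be a prime power and let $k$ and $s$ be nonnegative integers. For every sufficiently large integer $r$ (that is, for all $r\ge r_0$ with $r_0$ depending on $q,k,s$), there is an $\mathbb F_q$-representable matroid $M$ of rank $r$ such that \[ P_M(t)=\sum_{j=0}^{k}\binom{k}{j}_{q}t^j+s\,t . \]
   Context: Kazhdan--Lusztig polynomials. For a (finite) loopless matroid $M$, $L(M)$ is its lattice of flats, $\operatorname{rk}_M$ its rank function, and $M/F$ is the contraction by a flat $F$. The Kazhdan--Lusztig polynomials $P_M(t)\in\mathbb Z[t]$ are the unique family, indexed by loopless matroids $M$, such that: (i) $P_M(t)=1$ if $\operatorname{rk} M=0$; (ii) $\deg P_M(t)<\operatorname{rk} M/2$ if $\operatorname{rk} M>0$; (iii) for every $M$ the polynomial $Z_M(t)=\sum_{F\in L(M)}t^{\operatorname{rk}_M(F)}P_{M/F}(t)$ is palindromic of degree $\operatorname{rk} M$, i.e. $t^{\operatorname{rk} M}Z_M(t^{-1})=Z_M(t)$. All matroids here are loopless. Gaussian binomial. $\binom{m}{j}_{q}=\prod_{i=0}^{j-1}\frac{q^{m-i}-1}{q^{j-i}-1}$, the number of $j$-dimensional subspaces of $\mathbb F_q^m$. *)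

theory Defs
  imports
    "HOL-Library.Cardinality"
    "HOL-Computational_Algebra.Polynomial"
    "HOL-Number_Theory.Prime_Powers"
begin

section \<open>Finite matroids\<close>

record 'a matroid =
  ground :: "'a set"
  indeps :: "'a set set"

locale matroid =
  fixes M :: "'a matroid"
  assumes finite_ground: "finite (ground M)"
    and indeps_subset: "I \<in> indeps M \<Longrightarrow> I \<subseteq> ground M"
    and indeps_empty: "{} \<in> indeps M"
    and indeps_mono: "J \<in> indeps M \<Longrightarrow> I \<subseteq> J \<Longrightarrow> I \<in> indeps M"
    and indeps_augment: "I \<in> indeps M \<Longrightarrow> J \<in> indeps M \<Longrightarrow> card I < card J \<Longrightarrow>
      \<exists>e\<in>J - I. insert e I \<in> indeps M"

locale loopless_matroid = matroid +
  assumes loopless: "e \<in> ground M \<Longrightarrow> {e} \<in> indeps M"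

definition rk :: "'a matroid \<Rightarrow> 'a set \<Rightarrow> nat" where
  "rk M A = Max {card I | I. I \<in> indeps M \<and> I \<subseteq> A}"

abbreviation matroid_rank :: "'a matroid \<Rightarrow> nat" where
  "matroid_rank M \<equiv> rk M (ground M)"

definition flats :: "'a matroid \<Rightarrow> 'a set set" where
  "flats M = {F. F \<subseteq> ground M \<and> (\<forall>e\<in>ground M - F. rk M F < rk M (insert e F))}"

text \<open>A set is independent in the contraction iff its union with a basis of \<open>F\<close> is independent;
  the choice of the basis does not matter.\<close>

definition contract :: "'a matroid \<Rightarrow> 'a set \<Rightarrow> 'a matroid" where
  "contract M F = \<lparr> ground = ground M - F,
     indeps = {I. I \<subseteq> ground M - F \<and>
       (\<exists>B. B \<subseteq> F \<and> B \<in> indeps M \<and> card B = rk M F \<and> I \<union> B \<in> indeps M)} \<rparr>"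

text \<open>The matroid of a finite family of vectors \<open>v e\<close> (for \<open>e\<close> in the ground set) in the
  \<open>n\<close>-dimensional coordinate space over the field \<^typ>\<open>'f\<close>; only the coordinates below \<open>n\<close> are used,
  and distinct elements may be assigned the same vector.\<close>

definition lin_indep_family :: "nat \<Rightarrow> ('a \<Rightarrow> nat \<Rightarrow> 'f::field) \<Rightarrow> 'a set \<Rightarrow> bool" where
  "lin_indep_family n v S \<longleftrightarrow>
     (\<forall>c. (\<forall>i<n. (\<Sum>e\<in>S. c e * v e i) = 0) \<longrightarrow> (\<forall>e\<in>S. c e = 0))"

definition representable_over :: "'f::field itself \<Rightarrow> 'a matroid \<Rightarrow> bool" where
  "representable_over _ M \<longleftrightarrow>
     (\<exists>n. \<exists>v :: 'a \<Rightarrow> nat \<Rightarrow> 'f. \<forall>S. S \<subseteq> ground M \<longrightarrow> (S \<in> indeps M \<longleftrightarrow> lin_indep_family n v S))"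


section \<open>Kazhdan--Lusztig polynomials\<close>

text \<open>\<open>t^r p(1/t) = p(t)\<close>, compared coefficientwise.\<close>

definition palindromic :: "nat \<Rightarrow> 'a::zero poly \<Rightarrow> bool" where
  "palindromic r p \<longleftrightarrow> degree p \<le> r \<and> (\<forall>i\<le>r. coeff p i = coeff p (r - i))"

definition Z_poly :: "('a matroid \<Rightarrow> int poly) \<Rightarrow> 'a matroid \<Rightarrow> int poly" where
  "Z_poly P M = (\<Sum>F\<in>flats M. monom 1 (rk M F) * P (contract M F))"

definition kl_conditions :: "('a matroid \<Rightarrow> int poly) \<Rightarrow> 'a matroid \<Rightarrow> bool" where
  "kl_conditions P M \<longleftrightarrow>
     (matroid_rank M = 0 \<longrightarrow> P M = 1) \<and>
     (matroid_rank M > 0 \<longrightarrow> 2 * degree (P M) < matroid_rank M) \<and>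
     palindromic (matroid_rank M) (Z_poly P M)"

definition kl_family :: "('a matroid \<Rightarrow> int poly) \<Rightarrow> bool" where
  "kl_family P \<longleftrightarrow> (\<forall>M. loopless_matroid M \<longrightarrow> kl_conditions P M)"

text \<open>A Kazhdan--Lusztig family is determined on loopless matroids only, hence the pointwise
  description. Existence and uniqueness are proved below (\<open>kl_family_kl_poly\<close>, \<open>kl_family_unique\<close>).\<close>

definition kl_poly :: "'a matroid \<Rightarrow> int poly" where
  "kl_poly M = (THE p. \<exists>P. kl_family P \<and> P M = p)"


section \<open>Gaussian binomial coefficients\<close>

definition gaussian_binomial :: "nat \<Rightarrow> nat \<Rightarrow> nat \<Rightarrow> rat" where
  "gaussian_binomial q m j =
     (\<Prod>i<j. (of_nat q ^ (m - i) - 1) / (of_nat q ^ (j - i) - 1))"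


section \<open>Existence and uniqueness of the Kazhdan--Lusztig polynomials\<close>

context matroid
begin

lemma finite_indep: "I \<in> indeps M \<Longrightarrow> finite I"
  using finite_ground indeps_subset finite_subset by blast

lemma finite_indeps: "finite (indeps M)"
  by (rule finite_subset[of _ "Pow (ground M)"]) (use finite_ground indeps_subset in auto)

lemma card_le_rk: "I \<in> indeps M \<Longrightarrow> I \<subseteq> A \<Longrightarrow> card I \<le> rk M A"
  unfolding rk_def by (rule Max_ge) (auto simp: finite_indeps)

lemma obtain_basis:
  obtains B where "B \<in> indeps M" "B \<subseteq> A" "card B = rk M A"
proof -
  have "rk M A \<in> {card I | I. I \<in> indeps M \<and> I \<subseteq> A}"
    unfolding rk_def
  proof (rule Max_in)
    show "{card I | I. I \<in> indeps M \<and> I \<subseteq> A} \<noteq> {}" using indeps_empty by blast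
  qed (simp add: finite_indeps)
  then show ?thesis using that by auto
qed

lemma extend_basis:
  assumes "I \<in> indeps M" "I \<subseteq> A"
  obtains J where "J \<in> indeps M" "I \<subseteq> J" "J \<subseteq> A" "card J = rk M A"
proof -
  have "\<exists>J\<in>indeps M. I \<subseteq> J \<and> J \<subseteq> A \<and> card J = rk M A"
    using assms
  proof (induction "rk M A - card I" arbitrary: I rule: less_induct)
    case less
    show ?case
    proof (cases "card I = rk M A")
      case True
      then show ?thesis using less.prems by blast
    next
      case False
      then have lt: "card I < rk M A" using card_le_rk[OF less.prems] by simp
      obtain B where B: "B \<in> indeps M" "B \<subseteq> A" "card B = rk M A" by (rule obtain_basis)
      then obtain e where e: "e \<in> B - I" "insert e I \<in> indeps M"
        using indeps_augment[OF less.prems(1) B(1)] lt by auto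
      have "card (insert e I) = Suc (card I)" using e finite_indep[OF less.prems(1)] by auto
      then have "rk M A - card (insert e I) < rk M A - card I" using lt by simp
      moreover have "insert e I \<subseteq> A" using e B(2) less.prems(2) by blast
      ultimately show ?thesis using less.hyps[OF _ e(2)] by blast
    qed
  qed
  then show ?thesis using that by blast
qed

lemma rk_mono: "A \<subseteq> A' \<Longrightarrow> rk M A \<le> rk M A'"
proof -
  assume A: "A \<subseteq> A'"
  obtain B where "B \<in> indeps M" "B \<subseteq> A" "card B = rk M A" by (rule obtain_basis)
  then show ?thesis using card_le_rk[of B A'] A by auto
qed

lemma indep_change_basis:
  assumes I: "I \<inter> F = {}" "I \<union> B \<in> indeps M"
    and B: "B \<subseteq> F" "card B = rk M F"
    and B': "B' \<in> indeps M" "B' \<subseteq> F" "card B' = rk M F"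
  shows "I \<union> B' \<in> indeps M"
proof -
  obtain J where J: "J \<in> indeps M" "B' \<subseteq> J" "J \<subseteq> I \<union> F" "card J = rk M (I \<union> F)"
    using extend_basis[of B' "I \<union> F"] B' by auto
  have fin: "finite I" "finite B" "finite J"
    using finite_indep[OF I(2)] finite_indep[OF J(1)] by simp_all
  have "card I + rk M F = card (I \<union> B)"
  proof -
    have "I \<inter> B = {}" using I(1) B(1) by blast
    then show ?thesis using card_Un_disjoint[OF fin(1,2)] B(2) by simp
  qed
  also have "\<dots> \<le> card J"
  proof -
    have "I \<union> B \<subseteq> I \<union> F" using B(1) by blast
    then show ?thesis using card_le_rk[OF I(2)] J(4) by simp
  qed
  finally have ge: "card I + rk M F \<le> card J" .
  have split: "card J = card (J \<inter> F) + card (J - F)"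
    using card_Int_Diff fin by blast
  have JF: "card (J \<inter> F) \<le> rk M F"
    using card_le_rk[of "J \<inter> F" F] indeps_mono[OF J(1)] by auto
  have "J - F \<subseteq> I" using J by auto
  moreover have "card I \<le> card (J - F)" using ge split JF by linarith
  ultimately have "J - F = I" using card_seteq[OF fin(1)] by blast
  moreover have "J \<inter> F = B'"
    using card_seteq[of "J \<inter> F" B'] J(2) B'(2,3) JF fin(3) by simp
  ultimately have "J = I \<union> B'" by blast
  then show ?thesis using J by simp
qed

lemma ground_contract [simp]: "ground (contract M F) = ground M - F"
  by (simp add: contract_def)

lemma indeps_contract:
  assumes "B \<in> indeps M" "B \<subseteq> F" "card B = rk M F"
  shows "indeps (contract M F) = {I. I \<subseteq> ground M - F \<and> I \<union> B \<in> indeps M}"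
  unfolding contract_def using assms indep_change_basis[of _ F _ B] by auto

lemma matroid_contract: "matroid (contract M F)"
proof -
  obtain B where B: "B \<in> indeps M" "B \<subseteq> F" "card B = rk M F" by (rule obtain_basis)
  note ind = indeps_contract[OF B]
  show ?thesis
  proof
    fix I J assume IJ: "I \<in> indeps (contract M F)" "J \<in> indeps (contract M F)" "card I < card J"
    have fin: "finite I" "finite J" "finite B"
      using IJ B finite_indep unfolding ind by auto
    have "I \<inter> B = {}" "J \<inter> B = {}" using IJ B unfolding ind by blast+
    then have "card (I \<union> B) = card I + card B" "card (J \<union> B) = card J + card B"
      using fin by (simp_all add: card_Un_disjoint)
    then obtain e where "e \<in> (J \<union> B) - (I \<union> B)" "insert e (I \<union> B) \<in> indeps M"
      using indeps_augment[of "I \<union> B" "J \<union> B"] IJ unfolding ind by auto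
    then show "\<exists>e\<in>J - I. insert e I \<in> indeps (contract M F)"
      using IJ unfolding ind by auto
  next
    fix I J assume "J \<in> indeps (contract M F)" "I \<subseteq> J"
    then show "I \<in> indeps (contract M F)"
      unfolding ind using indeps_mono[of "J \<union> B" "I \<union> B"] by auto
  qed (use finite_ground B in \<open>auto simp: ind\<close>)
qed

lemma rk_contract:
  assumes X: "X \<subseteq> ground M - F"
  shows "rk (contract M F) X + rk M F = rk M (X \<union> F)"
proof (rule antisym)
  obtain B where B: "B \<in> indeps M" "B \<subseteq> F" "card B = rk M F" by (rule obtain_basis)
  note ind = indeps_contract[OF B]
  interpret N: matroid "contract M F" by (rule matroid_contract)
  show "rk (contract M F) X + rk M F \<le> rk M (X \<union> F)"
  proof -
    obtain I where I: "I \<in> indeps (contract M F)" "I \<subseteq> X" "card I = rk (contract M F) X"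
      by (rule N.obtain_basis)
    have "I \<inter> B = {}" using I B unfolding ind by blast
    then have "card (I \<union> B) = card I + card B"
      using card_Un_disjoint[OF N.finite_indep[OF I(1)] finite_indep[OF B(1)]] by blast
    moreover have "card (I \<union> B) \<le> rk M (X \<union> F)"
      using I B unfolding ind by (intro card_le_rk) auto
    ultimately show ?thesis using I B by simp
  qed
  show "rk M (X \<union> F) \<le> rk (contract M F) X + rk M F"
  proof -
    obtain J where J: "J \<in> indeps M" "B \<subseteq> J" "J \<subseteq> X \<union> F" "card J = rk M (X \<union> F)"
      using extend_basis[of B "X \<union> F"] B by auto
    have fin: "finite J" using J finite_indep by blast
    have JF: "card (J \<inter> F) \<le> rk M F"
      using card_le_rk[of "J \<inter> F" F] indeps_mono[OF J(1)] by auto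
    have "(J - F) \<union> B \<in> indeps M" using indeps_mono[OF J(1)] J by auto
    then have "J - F \<in> indeps (contract M F)" using J X unfolding ind by auto
    then have "card (J - F) \<le> rk (contract M F) X" using J by (intro N.card_le_rk) auto
    then show ?thesis using card_Int_Diff[OF fin, of F] JF J by linarith
  qed
qed

lemma rk_empty [simp]: "rk M {} = 0"
proof -
  obtain B where "B \<in> indeps M" "B \<subseteq> {}" "card B = rk M {}" by (rule obtain_basis)
  then show ?thesis by simp
qed

lemma contract_empty [simp]: "contract M {} = M"
proof -
  have "indeps (contract M {}) = indeps M"
    using indeps_contract[of "{}" "{}"] indeps_empty indeps_subset by auto
  then show ?thesis by (cases M) (simp add: contract_def)
qed

lemma finite_flats: "finite (flats M)"
  by (rule finite_subset[of _ "Pow (ground M)"]) (use finite_ground in \<open>auto simp: flats_def\<close>)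

end

context loopless_matroid
begin

lemma rank_eq_0_iff: "matroid_rank M = 0 \<longleftrightarrow> ground M = {}"
proof
  assume 0: "matroid_rank M = 0"
  have False if "e \<in> ground M" for e
    using card_le_rk[OF loopless[OF that], of "ground M"] that 0 by simp
  then show "ground M = {}" by blast
qed simp

lemma empty_flat: "{} \<in> flats M"
proof -
  have "0 < rk M {e}" if "e \<in> ground M" for e
    using card_le_rk[OF loopless[OF that], of "{e}"] by simp
  then show ?thesis by (simp add: flats_def)
qed

lemma loopless_contract:
  assumes F: "F \<in> flats M"
  shows "loopless_matroid (contract M F)"
proof -
  interpret N: matroid "contract M F" by (rule matroid_contract)
  show ?thesis
  proof
    fix e assume e: "e \<in> ground (contract M F)"
    then have "rk M F < rk M ({e} \<union> F)" using F by (auto simp: flats_def)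
    then have "rk (contract M F) {e} > 0" using rk_contract[of "{e}" F] e by auto
    moreover obtain I where I: "I \<in> indeps (contract M F)" "I \<subseteq> {e}"
        "card I = rk (contract M F) {e}"
      by (rule N.obtain_basis)
    ultimately have "I \<noteq> {}" by auto
    then have "I = {e}" using I(2) by blast
    then show "{e} \<in> indeps (contract M F)" using I(1) by simp
  qed
qed

lemma card_contract_less:
  assumes "F \<in> flats M" "F \<noteq> {}"
  shows "card (ground (contract M F)) < card (ground M)"
proof -
  have "ground M - F \<subset> ground M" using assms by (auto simp: flats_def)
  then show ?thesis using psubset_card_mono[OF finite_ground] by simp
qed

lemma contract_neq:
  assumes "F \<in> flats M" "F \<noteq> {}"
  shows "contract M F \<noteq> M"
proof
  assume "contract M F = M"
  then show False using card_contract_less[OF assms] by (simp only: less_irrefl)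
qed

lemma rank_contract:
  assumes "F \<in> flats M"
  shows "matroid_rank (contract M F) + rk M F = matroid_rank M"
proof -
  have "F \<subseteq> ground M" using assms by (simp add: flats_def)
  then have "ground M - F \<union> F = ground M" by blast
  then show ?thesis using rk_contract[of "ground M - F" F] by simp
qed

lemma Z_poly_split:
  "Z_poly P M = P M + (\<Sum>F\<in>flats M - {{}}. monom 1 (rk M F) * P (contract M F))"
  unfolding Z_poly_def
  by (subst sum.remove[OF finite_flats empty_flat])
    (simp only: rk_empty contract_empty monom_eq_1 mult_1_left)

lemma kl_conditions_unique:
  assumes P: "kl_conditions P M" and Q: "kl_conditions Q M"
    and eq: "\<And>F. F \<in> flats M \<Longrightarrow> F \<noteq> {} \<Longrightarrow> P (contract M F) = Q (contract M F)"
  shows "P M = Q M"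
proof (cases "matroid_rank M = 0")
  case True
  then show ?thesis using P Q by (simp add: kl_conditions_def)
next
  case False
  let ?r = "matroid_rank M"
  define D where "D = P M - Q M"
  have D: "D = Z_poly P M - Z_poly Q M"
    unfolding D_def Z_poly_split using eq by simp
  have deg: "2 * degree (P M) < ?r" "2 * degree (Q M) < ?r"
    using False P Q by (auto simp: kl_conditions_def)
  have high: "coeff D i = 0" if "?r \<le> 2 * i" for i
    unfolding D_def using that deg by (simp add: coeff_eq_0)
  have "coeff D i = 0" for i
  proof (cases "?r \<le> 2 * i")
    case False
    then have "i \<le> ?r" by simp
    moreover have "palindromic ?r (Z_poly P M)" "palindromic ?r (Z_poly Q M)"
      using P Q by (simp_all add: kl_conditions_def)
    ultimately have "coeff (Z_poly P M) i = coeff (Z_poly P M) (?r - i)"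
      "coeff (Z_poly Q M) i = coeff (Z_poly Q M) (?r - i)"
      unfolding palindromic_def by blast+
    then have "coeff D i = coeff D (?r - i)" by (simp only: D coeff_diff)
    also have "\<dots> = 0" using False by (intro high) auto
    finally show ?thesis .
  qed (rule high)
  then have "D = 0" by (simp add: poly_eq_iff)
  then show ?thesis by (simp add: D_def)
qed

lemma kl_conditions_exist:
  assumes P: "\<And>F. F \<in> flats M \<Longrightarrow> F \<noteq> {} \<Longrightarrow> kl_conditions P (contract M F)"
  shows "\<exists>p. kl_conditions (P(M := p)) M"
proof (cases "matroid_rank M = 0")
  case True
  have "flats M = {{}}"
    using True empty_flat rank_eq_0_iff by (auto simp: flats_def)
  then have "kl_conditions (P(M := 1)) M"
    using True by (simp add: kl_conditions_def Z_poly_split palindromic_def)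
  then show ?thesis ..
next
  case False
  let ?r = "matroid_rank M"
  define Y where "Y = (\<Sum>F\<in>flats M - {{}}. monom 1 (rk M F) * P (contract M F))"
  define p where "p = (\<Sum>i | 2 * i < ?r. monom (coeff Y (?r - i) - coeff Y i) i)"
  have fin: "finite {i. 2 * i < ?r}"
    by (rule finite_subset[of _ "{..<?r}"]) auto
  have coeff_p: "coeff p i = (if 2 * i < ?r then coeff Y (?r - i) - coeff Y i else 0)" for i
    unfolding p_def coeff_sum coeff_monom using fin by (simp add: sum.delta)
  have "degree Y \<le> ?r"
    unfolding Y_def
  proof (rule degree_sum_le)
    fix F assume F: "F \<in> flats M - {{}}"
    have "degree (P (contract M F)) \<le> matroid_rank (contract M F)"
      using P[of F] F by (cases "matroid_rank (contract M F) = 0") (auto simp: kl_conditions_def)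
    moreover have "degree (monom 1 (rk M F) * P (contract M F))
        \<le> rk M F + degree (P (contract M F))"
      by (rule order_trans[OF degree_mult_le]) (simp add: degree_monom_le)
    ultimately show "degree (monom 1 (rk M F) * P (contract M F)) \<le> ?r"
      using rank_contract[of F] F by auto
  qed (simp add: finite_flats)
  have Z: "Z_poly (P(M := p)) M = p + Y"
  proof -
    have "contract M F \<noteq> M" if "F \<in> flats M - {{}}" for F
      using contract_neq[of F] that by blast
    then show ?thesis unfolding Z_poly_split Y_def by simp
  qed
  have deg_p: "2 * degree p < ?r"
  proof (cases "p = 0")
    case False
    then have "coeff p (degree p) \<noteq> 0" by simp
    then show ?thesis unfolding coeff_p by (auto split: if_splits)
  qed (use False in simp)
  have "coeff (p + Y) i = coeff (p + Y) (?r - i)" if "i \<le> ?r" for i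
  proof -
    consider "2 * i < ?r" | "2 * i = ?r" | "2 * i > ?r" by linarith
    then show ?thesis
    proof cases
      case 2
      then have "?r - i = i" by linarith
      then show ?thesis by simp
    qed (use that in \<open>auto simp: coeff_p\<close>)
  qed
  moreover have "degree (p + Y) \<le> ?r"
    using deg_p \<open>degree Y \<le> ?r\<close> by (intro degree_add_le) auto
  ultimately have "palindromic ?r (p + Y)" unfolding palindromic_def by blast
  then have "kl_conditions (P(M := p)) M"
    using False deg_p by (simp add: kl_conditions_def Z)
  then show ?thesis ..
qed

end

lemma kl_conditions_cong:
  assumes "loopless_matroid M" and "\<And>F. F \<in> flats M \<Longrightarrow> P (contract M F) = Q (contract M F)"
  shows "kl_conditions P M \<longleftrightarrow> kl_conditions Q M"
proof -
  interpret loopless_matroid M by fact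
  have "P M = Q M" using assms(2)[OF empty_flat] by simp
  moreover have "Z_poly P M = Z_poly Q M" unfolding Z_poly_def using assms(2) by simp
  ultimately show ?thesis by (simp add: kl_conditions_def)
qed

lemma kl_family_unique_aux:
  assumes P: "\<And>N. loopless_matroid N \<Longrightarrow> card (ground N) \<le> n \<Longrightarrow> kl_conditions P N"
    and Q: "\<And>N. loopless_matroid N \<Longrightarrow> card (ground N) \<le> n \<Longrightarrow> kl_conditions Q N"
    and M: "loopless_matroid M" "card (ground M) \<le> n"
  shows "P M = Q M"
  using M
proof (induction "card (ground M)" arbitrary: M rule: less_induct)
  case less
  interpret loopless_matroid M by fact
  show ?case
  proof (rule kl_conditions_unique)
    fix F assume F: "F \<in> flats M" "F \<noteq> {}"
    then show "P (contract M F) = Q (contract M F)"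
      using card_contract_less[OF F] less.prems
      by (intro less.hyps loopless_contract) auto
  qed (use P Q less.prems in auto)
qed

theorem kl_family_unique:
  assumes "kl_family P" "kl_family Q" "loopless_matroid M"
  shows "P M = Q M"
  using kl_family_unique_aux[of "card (ground M)" P Q M] assms by (auto simp: kl_family_def)

theorem kl_family_exists: "\<exists>P :: 'a matroid \<Rightarrow> int poly. kl_family P"
proof -
  define good where "good n P \<longleftrightarrow>
    (\<forall>M. loopless_matroid M \<longrightarrow> card (ground M) < n \<longrightarrow> kl_conditions P M)"
    for n and P :: "'a matroid \<Rightarrow> int poly"
  have step: "\<exists>P'. good (Suc n) P'" if P: "good n P" for n P
  proof -
    define s where "s M = (SOME p. kl_conditions (P(M := p)) M)" for M
    define P' where "P' N = (if card (ground N) < n then P N else s N)" for N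
    have "kl_conditions P' M" if M: "loopless_matroid M" "card (ground M) < Suc n" for M
    proof -
      interpret loopless_matroid M by (rule M(1))
      have lt: "card (ground (contract M F)) < n" if "F \<in> flats M" "F \<noteq> {}" for F
        using card_contract_less[OF that] M(2) by linarith
      show ?thesis
      proof (cases "card (ground M) < n")
        case True
        have "P' (contract M F) = P (contract M F)" if "F \<in> flats M" for F
          unfolding P'_def using lt[of F] that True by (cases "F = {}") simp_all
        then have "kl_conditions P' M \<longleftrightarrow> kl_conditions P M"
          by (rule kl_conditions_cong[OF M(1)])
        then show ?thesis using P M True by (simp add: good_def)
      next
        case False
        have "kl_conditions P (contract M F)" if "F \<in> flats M" "F \<noteq> {}" for F
          using P loopless_contract[OF that(1)] lt[OF that] by (simp add: good_def)
        then have "\<exists>p. kl_conditions (P(M := p)) M" by (rule kl_conditions_exist)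
        then have *: "kl_conditions (P(M := s M)) M"
          unfolding s_def by (rule someI_ex)
        have "P' (contract M F) = (P(M := s M)) (contract M F)" if "F \<in> flats M" for F
        proof (cases "F = {}")
          case True
          then show ?thesis unfolding P'_def using False by simp
        next
          case ne: False
          show ?thesis
            unfolding P'_def fun_upd_apply using lt[OF that ne] contract_neq[OF that ne]
            by (simp only: if_True if_False)
        qed
        then have "kl_conditions P' M \<longleftrightarrow> kl_conditions (P(M := s M)) M"
          by (rule kl_conditions_cong[OF M(1)])
        then show ?thesis using * by (rule iffD2)
      qed
    qed
    then have "good (Suc n) P'" by (simp add: good_def)
    then show ?thesis by (rule exI[of _ P'])
  qed
  have "\<exists>P. good n P" for n
  proof (induction n)
    case 0
    show ?case by (simp add: good_def)
  next
    case (Suc n)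
    then obtain P where "good n P" ..
    then show ?case by (rule step)
  qed
  then have "\<exists>K. \<forall>n. good n (K n)" by (intro choice allI)
  then obtain K where K: "good n (K n)" for n by blast
  define P where "P M = K (Suc (card (ground M))) M" for M
  have "kl_conditions P M" if M: "loopless_matroid M" for M
  proof -
    interpret loopless_matroid M by (rule M)
    let ?Q = "K (Suc (card (ground M)))"
    have "P (contract M F) = ?Q (contract M F)" if F: "F \<in> flats M" for F
      unfolding P_def
    proof (rule kl_family_unique_aux[of "card (ground (contract M F))"
          "K (Suc (card (ground (contract M F))))" ?Q])
      fix N :: "'a matroid"
      assume N: "loopless_matroid N" "card (ground N) \<le> card (ground (contract M F))"
      show "kl_conditions (K (Suc (card (ground (contract M F))))) N"
        using K[unfolded good_def, rule_format, OF N(1)] N(2) by (simp only: less_Suc_eq_le)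
      have "card (ground (contract M F)) \<le> card (ground M)"
        using finite_ground by (simp add: card_mono)
      then show "kl_conditions ?Q N"
        using K[unfolded good_def, rule_format, OF N(1)] N(2) by (simp only: less_Suc_eq_le)
    qed (simp_all add: loopless_contract[OF F])
    then have "kl_conditions P M \<longleftrightarrow> kl_conditions ?Q M"
      by (rule kl_conditions_cong[OF M])
    then show ?thesis using K[unfolded good_def, rule_format, OF M] by simp
  qed
  then show ?thesis unfolding kl_family_def by blast
qed

theorem kl_poly_eq:
  assumes "kl_family P" "loopless_matroid M"
  shows "kl_poly M = P M"
  unfolding kl_poly_def
proof (rule the_equality)
  show "\<exists>Q. kl_family Q \<and> Q M = P M" using assms(1) by blast
  show "p = P M" if "\<exists>Q. kl_family Q \<and> Q M = p" for p
    using that kl_family_unique[OF _ assms(1,2)] by blast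
qed

theorem kl_family_kl_poly: "kl_family kl_poly"
proof -
  obtain P :: "'a matroid \<Rightarrow> int poly" where P: "kl_family P" using kl_family_exists by blast
  have "kl_conditions kl_poly M" if M: "loopless_matroid M" for M :: "'a matroid"
  proof -
    have "kl_poly (contract M F) = P (contract M F)" if "F \<in> flats M" for F
      using kl_poly_eq[OF P] loopless_matroid.loopless_contract[OF M that] by blast
    then have "kl_conditions kl_poly M \<longleftrightarrow> kl_conditions P M"
      by (intro kl_conditions_cong M)
    then show ?thesis using P M by (simp add: kl_family_def)
  qed
  then show ?thesis by (simp add: kl_family_def)
qed

end

theory Submission
  imports Defs "HOL-Library.Function_Algebras"
begin

text \<open>Let \<open>M\<close> be the matroid of the vectors of \<open>V = GF(q)\<^sup>r\<close> outside a set \<open>X\<close> containing \<open>0\<close>. Sending a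
  subspace \<open>L\<close> of \<open>V\<close> to the flat \<open>L - X\<close> partitions the subspaces, and the lattice of all subspaces
  has palindromic rank generating functions on its upper intervals. Hence the polynomials
  \<open>Q F = (\<Sum>L. t ^ (dim L - rk F))\<close>, where \<open>L\<close> ranges over the subspaces with \<open>L - X = F\<close>, satisfy the
  palindromicity conditions for \<open>M\<close>. They also satisfy the degree bound once \<open>r\<close> is large compared with
  \<open>card X\<close>, because \<open>L\<close> is either spanned by \<open>L - X\<close> or has at most \<open>2 * card X\<close> elements. So
  \<open>P\<^sub>M\<close> is the sum of \<open>t ^ dim L\<close> over the subspaces \<open>L \<subseteq> X\<close>. Taking for \<open>X\<close> the union of a
  \<open>k\<close>-dimensional coordinate subspace and \<open>s\<close> further coordinate axes gives the claim.\<close>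

section \<open>Kazhdan--Lusztig polynomials of the intervals of a lattice of flats\<close>

context matroid
begin

text \<open>A basis \<open>B\<close> of \<open>F\<close> together with a basis \<open>C\<close> of
  \<open>G - F\<close> in the contraction is a basis of \<open>G\<close>, so both sides test
  independence against \<open>C \<union> B\<close>. Iterated contractions can thus be indexed by
  flats of \<open>M\<close>.\<close>

lemma contract_contract:
  assumes FG: "F \<subseteq> G" and G: "G \<subseteq> ground M"
  shows "contract (contract M F) (G - F) = contract M G"
proof -
  interpret N: matroid "contract M F" by (rule matroid_contract)
  obtain B where B: "B \<in> indeps M" "B \<subseteq> F" "card B = rk M F" by (rule obtain_basis)
  note ind = indeps_contract[OF B]
  obtain C where C: "C \<in> indeps (contract M F)" "C \<subseteq> G - F" "card C = rk (contract M F) (G - F)"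
    by (rule N.obtain_basis)
  have BC: "C \<union> B \<in> indeps M" using C(1) unfolding ind by blast
  have "card (C \<union> B) = card C + card B"
    using B C by (intro card_Un_disjoint N.finite_indep finite_indep) auto
  moreover have "G - F \<subseteq> ground M - F" "G - F \<union> F = G" using FG G by blast+
  ultimately have "card (C \<union> B) = rk M G"
    using rk_contract[of "G - F" F] B C by simp
  moreover have "C \<union> B \<subseteq> G" using B C FG by blast
  ultimately have G_ind: "indeps (contract M G) = {I. I \<subseteq> ground M - G \<and> I \<union> (C \<union> B) \<in> indeps M}"
    using indeps_contract[OF BC] by blast
  have "ground M - F - (G - F) = ground M - G" using FG by blast
  moreover have "I \<subseteq> ground M - G \<Longrightarrow> I \<union> C \<subseteq> ground M - F" for I
    using FG G C(2) by blast
  ultimately have "indeps (contract (contract M F) (G - F)) = indeps (contract M G)"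
    unfolding N.indeps_contract[OF C] G_ind ind by (auto simp: Un_assoc)
  moreover have "ground (contract (contract M F) (G - F)) = ground (contract M G)"
    using FG by auto
  ultimately show ?thesis by (intro matroid.equality) auto
qed

text \<open>Contraction shifts ranks by the constant \<open>rk M F\<close>, so an element raises the
  rank of \<open>H\<close> in the contraction exactly when it raises that of
  \<open>H \<union> F\<close> in \<open>M\<close>.\<close>

lemma flats_contract:
  assumes F: "F \<subseteq> ground M"
  shows "flats (contract M F) = (\<lambda>G. G - F) ` {G \<in> flats M. F \<subseteq> G}"
proof -
  have *: "H \<in> flats (contract M F) \<longleftrightarrow> H \<union> F \<in> flats M" if H: "H \<subseteq> ground M - F" for H
  proof -
    have "rk (contract M F) H < rk (contract M F) (insert e H) \<longleftrightarrow>
        rk M (H \<union> F) < rk M (insert e (H \<union> F))" if "e \<in> ground M - F" for e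
      using rk_contract[OF H] rk_contract[of "insert e H" F] that H by auto
    then show ?thesis using H F by (auto simp: flats_def)
  qed
  show ?thesis
  proof (intro equalityI subsetI)
    fix H assume H: "H \<in> flats (contract M F)"
    then have "H \<subseteq> ground M - F" by (simp add: flats_def)
    then show "H \<in> (\<lambda>G. G - F) ` {G \<in> flats M. F \<subseteq> G}"
      using *[of H] H by (intro image_eqI[of _ _ "H \<union> F"]) auto
  next
    fix H assume "H \<in> (\<lambda>G. G - F) ` {G \<in> flats M. F \<subseteq> G}"
    then obtain G where G: "G \<in> flats M" "F \<subseteq> G" "H = G - F" by blast
    then have "H \<subseteq> ground M - F" "H \<union> F = G" by (auto simp: flats_def)
    then show "H \<in> flats (contract M F)" using *[of H] G by simp
  qed
qed

end

context loopless_matroid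
begin

text \<open>The hypotheses are the defining conditions for all contractions at once, with
  \<open>Q F\<close> in place of the polynomial of \<open>contract M F\<close>. Uniqueness, applied
  by induction on the complement of \<open>F\<close>, then identifies the two.\<close>

lemma kl_poly_interval:
  assumes top: "\<And>F. F \<in> flats M \<Longrightarrow> rk M F = matroid_rank M \<Longrightarrow> Q F = 1"
    and deg: "\<And>F. F \<in> flats M \<Longrightarrow> rk M F < matroid_rank M \<Longrightarrow>
      2 * degree (Q F) < matroid_rank M - rk M F"
    and pal: "\<And>F. F \<in> flats M \<Longrightarrow> palindromic (matroid_rank M - rk M F)
      (\<Sum>G | G \<in> flats M \<and> F \<subseteq> G. monom 1 (rk M G - rk M F) * Q G)"
  shows "F \<in> flats M \<Longrightarrow> kl_poly (contract M F) = Q F"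
proof (induction "card (ground M - F)" arbitrary: F rule: less_induct)
  case less
  \<comment> \<open>The conditions concern functions of matroids, so \<open>Q\<close> is
    transported: \<open>G\<close> is recovered from \<open>contract M G\<close> as the complement of
    its ground set.\<close>
  define Q' where "Q' N = Q (ground M - ground N)" for N :: "'a matroid"
  have Q': "Q' (contract M G) = Q G" if "G \<in> flats M" for G
    using that by (simp add: Q'_def flats_def double_diff)
  interpret N: loopless_matroid "contract M F" using less.prems by (rule loopless_contract)
  have F: "F \<subseteq> ground M" using less.prems by (simp add: flats_def)
  have flatD: "G \<subseteq> ground M" if "G \<in> flats M" for G using that by (simp add: flats_def)
  have rank: "matroid_rank (contract M F) = matroid_rank M - rk M F"
    using rank_contract[OF less.prems] by linarith
  have rkF: "rk M F \<le> matroid_rank M" using F by (rule rk_mono)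
  have "kl_poly (contract M F) = Q' (contract M F)"
  proof (rule N.kl_conditions_unique)
    show "kl_conditions kl_poly (contract M F)"
      using kl_family_kl_poly N.loopless_matroid_axioms unfolding kl_family_def by blast
    have "Z_poly Q' (contract M F) =
        (\<Sum>G | G \<in> flats M \<and> F \<subseteq> G. monom 1 (rk M G - rk M F) * Q G)"
      unfolding Z_poly_def flats_contract[OF F]
    proof (subst sum.reindex)
      show "inj_on (\<lambda>G. G - F) {G \<in> flats M. F \<subseteq> G}" by (rule inj_onI) blast
      show "sum ((\<lambda>H. monom 1 (rk (contract M F) H) * Q' (contract (contract M F) H)) \<circ> (\<lambda>G. G - F))
          {G \<in> flats M. F \<subseteq> G} =
        (\<Sum>G | G \<in> flats M \<and> F \<subseteq> G. monom 1 (rk M G - rk M F) * Q G)"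
      proof (rule sum.cong)
        fix G assume G: "G \<in> {G \<in> flats M. F \<subseteq> G}"
        then have "G - F \<subseteq> ground M - F" "G - F \<union> F = G" using flatD by auto
        then have "rk (contract M F) (G - F) = rk M G - rk M F"
          using rk_contract[of "G - F" F] by simp
        then show "((\<lambda>H. monom 1 (rk (contract M F) H) * Q' (contract (contract M F) H)) \<circ> (\<lambda>G. G - F)) G =
            monom 1 (rk M G - rk M F) * Q G"
          using G flatD by (simp add: contract_contract Q')
      qed simp
    qed
    then show "kl_conditions Q' (contract M F)"
      unfolding kl_conditions_def rank Q'[OF less.prems]
      using top[OF less.prems] deg[OF less.prems] pal[OF less.prems] rkF by auto
    fix H assume H: "H \<in> flats (contract M F)" "H \<noteq> {}"
    then obtain G where G: "G \<in> flats M" "F \<subseteq> G" "H = G - F"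
      unfolding flats_contract[OF F] by blast
    have "ground M - G \<subset> ground M - F" using H(2) G flatD[OF G(1)] by blast
    then have "card (ground M - G) < card (ground M - F)"
      using finite_ground by (intro psubset_card_mono) auto
    then show "kl_poly (contract (contract M F) H) = Q' (contract (contract M F) H)"
      using less.hyps[OF _ G(1)] G flatD by (simp add: contract_contract Q')
  qed
  then show ?case using Q'[OF less.prems] by simp
qed

end

section \<open>Subspaces of finite vector spaces\<close>

lemma gaussian_binomial_0 [simp]: "gaussian_binomial q m 0 = 1"
  by (simp add: gaussian_binomial_def)

text \<open>The factor \<open>i = 0\<close> splits off and the others shift by one. Counting
  subspaces by dimension yields the same recursion.\<close>

lemma gaussian_binomial_Suc:
  "gaussian_binomial q m (Suc j) =
    (of_nat q ^ m - 1) / (of_nat q ^ Suc j - 1) * gaussian_binomial q (m - 1) j"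
  unfolding gaussian_binomial_def by (subst prod.lessThan_Suc_shift) simp

lemma gaussian_binomial_eq_0: "m < j \<Longrightarrow> gaussian_binomial q m j = 0"
  unfolding gaussian_binomial_def by (rule prod_zero) (auto intro: bexI[of _ m])

text \<open>The q-factorial formula, cleared of denominators and of powers of \<open>q - 1\<close>;
  the two products beside the binomial trade places under exchange of \<open>j\<close> and
  \<open>m - j\<close>, whence the symmetry below.\<close>

lemma gaussian_binomial_qfact:
  assumes "j \<le> m" and q: "2 \<le> q"
  shows "gaussian_binomial q m j * (\<Prod>i<j. of_nat q ^ Suc i - 1) * (\<Prod>i<m - j. of_nat q ^ Suc i - 1) =
    (\<Prod>i<m. of_nat q ^ Suc i - 1)"
  using \<open>j \<le> m\<close>
proof (induction j arbitrary: m)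
  case (Suc j)
  then obtain n where n: "m = Suc n" "j \<le> n" by (cases m) auto
  have "of_nat q ^ Suc j \<noteq> (1 :: rat)"
    using one_less_power[of "of_nat q :: rat" "Suc j"] q by auto
  then have "gaussian_binomial q m (Suc j) * (of_nat q ^ Suc j - 1) =
      (of_nat q ^ m - 1) * gaussian_binomial q n j"
    using n by (simp add: gaussian_binomial_Suc del: power_Suc)
  then have "gaussian_binomial q m (Suc j) * (\<Prod>i<Suc j. of_nat q ^ Suc i - 1) *
        (\<Prod>i<m - Suc j. of_nat q ^ Suc i - 1) =
      (gaussian_binomial q n j * (\<Prod>i<j. of_nat q ^ Suc i - 1) *
        (\<Prod>i<n - j. of_nat q ^ Suc i - 1)) * (of_nat q ^ m - 1)"
    unfolding prod.lessThan_Suc using n(1) by (simp add: ac_simps del: power_Suc)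
  also have "\<dots> = (\<Prod>i<n. of_nat q ^ Suc i - 1) * (of_nat q ^ m - 1)"
    unfolding Suc.IH[OF n(2)] ..
  finally show ?case unfolding n(1) prod.lessThan_Suc .
qed simp

lemma gaussian_binomial_symmetric:
  assumes "j \<le> m" and q: "2 \<le> q"
  shows "gaussian_binomial q m j = gaussian_binomial q m (m - j)"
proof -
  have "of_nat q ^ Suc i - 1 \<noteq> (0 :: rat)" for i
    using one_less_power[of "of_nat q :: rat" "Suc i"] q by auto
  then have nz: "(\<Prod>i<n. of_nat q ^ Suc i - 1) \<noteq> (0 :: rat)" for n by simp
  have "gaussian_binomial q m j *
        ((\<Prod>i<j. of_nat q ^ Suc i - 1) * (\<Prod>i<m - j. of_nat q ^ Suc i - 1)) =
      gaussian_binomial q m (m - j) *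
        ((\<Prod>i<j. of_nat q ^ Suc i - 1) * (\<Prod>i<m - j. of_nat q ^ Suc i - 1))"
    using gaussian_binomial_qfact[OF assms] gaussian_binomial_qfact[OF _ q, of "m - j" m] \<open>j \<le> m\<close>
    by (simp add: ac_simps del: power_Suc)
  then show ?thesis using nz by (simp del: power_Suc)
qed

section \<open>Cardinality and dimension over a finite field\<close>

locale finite_field_vector_space = vector_space scale
  for scale :: "'f::{field,finite} \<Rightarrow> 'b::ab_group_add \<Rightarrow> 'b"
begin

lemma two_le_card_field: "2 \<le> CARD('f)"
proof -
  have "card {0, 1 :: 'f} \<le> CARD('f)" by (intro card_mono) auto
  then show ?thesis by simp
qed

text \<open>Each vector of the larger span is uniquely \<open>scale c x + y\<close> with
  \<open>y\<close> in the span of \<open>S\<close>: two values of \<open>c\<close> would put a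
  nonzero multiple of \<open>x\<close>, hence \<open>x\<close>, into that span.\<close>

lemma card_span_insert:
  assumes "x \<notin> span S"
  shows "card (span (insert x S)) = CARD('f) * card (span S)"
proof -
  have "bij_betw (\<lambda>(c, y). scale c x + y) (UNIV \<times> span S) (span (insert x S))"
  proof (rule bij_betw_imageI)
    show "inj_on (\<lambda>(c, y). scale c x + y) (UNIV \<times> span S)"
    proof (rule inj_onI, clarify)
      fix c y d z assume y: "y \<in> span S" and z: "z \<in> span S"
        and eq: "scale c x + y = scale d x + z"
      have "scale (c - d) x = z - y"
        using eq by (simp add: scale_left_diff_distrib algebra_simps)
      then have *: "scale (c - d) x \<in> span S" using span_diff[OF z y] by simp
      have "c = d"
      proof (rule ccontr)
        assume "c \<noteq> d"
        then show False using span_scale[OF *, of "inverse (c - d)"] assms by simp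
      qed
      then show "c = d \<and> y = z" using eq by simp
    qed
    show "(\<lambda>(c, y). scale c x + y) ` (UNIV \<times> span S) = span (insert x S)"
    proof (intro equalityI subsetI)
      fix z assume "z \<in> span (insert x S)"
      then obtain c where "z - scale c x \<in> span S" by (auto simp: span_insert)
      then show "z \<in> (\<lambda>(c, y). scale c x + y) ` (UNIV \<times> span S)"
        by (intro image_eqI[of _ _ "(c, z - scale c x)"]) auto
    next
      fix z assume "z \<in> (\<lambda>(c, y). scale c x + y) ` (UNIV \<times> span S)"
      then obtain c y where "y \<in> span S" "z = scale c x + y" by auto
      then show "z \<in> span (insert x S)" unfolding span_insert by (auto intro!: exI[of _ c])
    qed
  qed
  from bij_betw_same_card[OF this] show ?thesis by (simp add: card_cartesian_product)
qed

lemma card_span_independent: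
  assumes "finite B" "independent B"
  shows "card (span B) = CARD('f) ^ card B"
  using assms
proof (induction B)
  case (insert x B)
  then have "x \<notin> span B" "independent B" by (simp_all add: independent_insert)
  then show ?case using insert by (simp add: card_span_insert)
qed simp

lemma finite_span:
  assumes "finite S"
  shows "finite (span S)"
proof -
  \<comment> \<open>An infinite set has \<open>card\<close> 0, so a cardinality that is a power of
    \<open>CARD('f)\<close> certifies finiteness.\<close>
  have "finite (span B)" if "finite B" "independent B" for B
    using card_span_independent[OF that] card_gt_0_iff[of "span B"] zero_less_card_finite[where 'a='f]
    by simp
  moreover obtain B where "B \<subseteq> S" "independent B" "S \<subseteq> span B" by (rule basis_exists)
  ultimately show ?thesis using assms by (metis finite_subset span_mono span_span)
qed

lemma card_subspace:
  assumes "subspace S" "finite S"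
  shows "card S = CARD('f) ^ dim S"
proof -
  obtain B where B: "B \<subseteq> S" "independent B" "S \<subseteq> span B" "card B = dim S" by (rule basis_exists)
  then have "span B = S" using assms(1) by (intro span_subspace)
  then show ?thesis
    using card_span_independent[of B] B assms(2) by (metis finite_subset)
qed

lemma dim_mono:
  assumes "S \<subseteq> T" "finite T"
  shows "dim S \<le> dim T"
proof -
  obtain B where B: "B \<subseteq> T" "independent B" "T \<subseteq> span B" "card B = dim T" by (rule basis_exists)
  then have "S \<subseteq> span B" using assms(1) by blast
  then show ?thesis using dim_le_card[of S B] B assms(2) by (metis finite_subset)
qed

lemma subspace_eqI:
  assumes "subspace W" "subspace L" "W \<subseteq> L" "finite L" "dim L \<le> dim W"
  shows "W = L"
proof (rule card_seteq)
  have "card L = CARD('f) ^ dim L" "card W = CARD('f) ^ dim W"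
    using assms by (auto intro!: card_subspace elim: finite_subset)
  then show "card L \<le> card W"
    using assms(5) by (auto intro!: power_increasing simp: zero_less_card_finite Suc_le_eq)
qed (use assms in auto)

text \<open>Dimensions are read off as exponents of cardinalities, since \<open>CARD('f)\<close> is
  at least 2.\<close>

lemma dim_span_insert:
  assumes "finite S" "x \<notin> span S"
  shows "dim (insert x S) = Suc (dim S)"
proof -
  have "CARD('f) ^ dim (insert x S) = CARD('f) ^ Suc (dim S)"
    using card_span_insert[OF assms(2)] assms(1)
      card_subspace[of "span (insert x S)"] card_subspace[of "span S"]
    by (simp add: finite_span)
  then show ?thesis using two_le_card_field by (subst (asm) power_inject_exp) auto
qed

section \<open>Counting the subspaces in an interval\<close>

definition intermediate :: "'b set \<Rightarrow> 'b set \<Rightarrow> 'b set set" where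
  "intermediate W V = {L. subspace L \<and> W \<subseteq> L \<and> L \<subseteq> V}"

lemma finite_intermediate [simp]: "finite V \<Longrightarrow> finite (intermediate W V)"
  by (rule finite_subset[of _ "Pow V"]) (auto simp: intermediate_def)

text \<open>Double counting of the pairs \<open>(x, L)\<close> with \<open>x \<in> L - W\<close> reduces the subspaces over \<open>W\<close>
  to those over \<open>W + \<langle>x\<rangle>\<close>.\<close>

lemma card_intermediate:
  assumes "finite V" "subspace V" "subspace W" "W \<subseteq> V"
  shows "of_nat (card {L \<in> intermediate W V. dim L = dim W + j}) =
    gaussian_binomial CARD('f) (dim V - dim W) j"
  using assms
proof (induction j arbitrary: W)
  case 0
  have "L = W" if "L \<in> intermediate W V" "dim L = dim W" for L
    using that 0 subspace_eqI[of W L] by (auto simp: intermediate_def intro: finite_subset)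
  then have "{L \<in> intermediate W V. dim L = dim W + 0} = {W}"
    using 0 by (auto simp: intermediate_def)
  then show ?case by simp
next
  case (Suc j)
  let ?q = "of_nat CARD('f) :: rat"
  define w where "w = dim W"
  define m where "m = dim V - w"
  define \<L> where "\<L> = {L \<in> intermediate W V. dim L = w + Suc j}"
  have finW: "finite W" using Suc.prems by (auto intro: finite_subset)
  have spanW: "span W = W" using Suc.prems by simp
  have wV: "w \<le> dim V" unfolding w_def using Suc.prems by (intro dim_mono) auto
  have card_W: "card W = CARD('f) ^ w" using Suc.prems finW by (simp add: card_subspace w_def)
  have card_V: "card V = CARD('f) ^ dim V" using Suc.prems by (simp add: card_subspace)
  have card_diff: "of_nat (card (A - B)) = (of_nat (card A) - of_nat (card B) :: rat)"
    if "finite A" "B \<subseteq> A" for A B :: "'b set"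
    using that by (simp add: card_Diff_subset card_mono finite_subset of_nat_diff)
  \<comment> \<open>The subspaces in \<open>\<L>\<close> through \<open>x\<close> are those over
    \<open>?Wx\<close>, whose dimension is one larger, so only \<open>j\<close> further dimensions
    remain and the induction hypothesis applies.\<close>
  have over_x: "of_nat (card {L \<in> \<L>. x \<in> L}) = gaussian_binomial CARD('f) (m - 1) j"
    if x: "x \<in> V - W" for x
  proof -
    let ?Wx = "span (insert x W)"
    have dim: "dim ?Wx = Suc w"
      using dim_span_insert[of W x] finW x spanW by (simp add: w_def)
    have "?Wx \<subseteq> L \<longleftrightarrow> x \<in> L \<and> W \<subseteq> L" if "subspace L" for L
      using that span_minimal[of "insert x W" L] span_superset[of "insert x W"] by auto
    then have "{L \<in> \<L>. x \<in> L} = {L \<in> intermediate ?Wx V. dim L = dim ?Wx + j}"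
      unfolding dim by (auto simp: \<L>_def intermediate_def)
    moreover have "dim V - dim ?Wx = m - 1" unfolding dim by (simp add: m_def)
    moreover have "?Wx \<subseteq> V" using x Suc.prems by (intro span_minimal) auto
    ultimately show ?thesis using Suc.IH[of ?Wx] Suc.prems by simp
  qed
  have finL: "finite \<L>" unfolding \<L>_def using Suc.prems by simp
  have "of_nat (card \<L>) * (?q ^ (w + Suc j) - ?q ^ w) = (\<Sum>L\<in>\<L>. of_nat (card {x \<in> V - W. x \<in> L}))"
  proof -
    have "of_nat (card {x \<in> V - W. x \<in> L}) = ?q ^ (w + Suc j) - ?q ^ w" if L: "L \<in> \<L>" for L
    proof -
      have L': "subspace L" "W \<subseteq> L" "L \<subseteq> V" "dim L = w + Suc j" "finite L"
        using L Suc.prems by (auto simp: \<L>_def intermediate_def intro: finite_subset)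
      have "{x \<in> V - W. x \<in> L} = L - W" using L' by auto
      then show ?thesis using L' card_subspace[of L] by (simp add: card_diff card_W)
    qed
    then show ?thesis by simp
  qed
  also have "\<dots> = of_nat (\<Sum>L\<in>\<L>. card {x \<in> V - W. x \<in> L})" by simp
  also have "(\<Sum>L\<in>\<L>. card {x \<in> V - W. x \<in> L}) = (\<Sum>x\<in>V - W. card {L \<in> \<L>. x \<in> L})"
    using finL Suc.prems by (intro sum_multicount_gen) auto
  also have "of_nat (\<Sum>x\<in>V - W. card {L \<in> \<L>. x \<in> L}) =
      (?q ^ dim V - ?q ^ w) * gaussian_binomial CARD('f) (m - 1) j"
    using Suc.prems by (simp add: over_x card_diff card_W card_V)
  \<comment> \<open>Since \<open>w \<le> dim V\<close>, both counts contain the factor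
    \<open>?q ^ w\<close>; cancelling it leaves the recursion of
    \<open>gaussian_binomial_Suc\<close>.\<close>
  finally have "?q ^ w * (of_nat (card \<L>) * (?q ^ Suc j - 1)) =
      ?q ^ w * ((?q ^ m - 1) * gaussian_binomial CARD('f) (m - 1) j)"
    using wV by (simp add: m_def power_add algebra_simps flip: power_add)
  then have eq: "of_nat (card \<L>) * (?q ^ Suc j - 1) = (?q ^ m - 1) * gaussian_binomial CARD('f) (m - 1) j"
    by (subst (asm) mult_left_cancel) (simp_all add: zero_less_card_finite)
  have "?q ^ Suc j \<noteq> 1"
    using one_less_power[of ?q "Suc j"] two_le_card_field by auto
  then have "of_nat (card \<L>) = gaussian_binomial CARD('f) m (Suc j)"
    using eq by (simp add: gaussian_binomial_Suc field_simps)
  then show ?case by (simp add: \<L>_def m_def w_def)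
qed

lemma coeff_sum_intermediate:
  assumes "finite V" "subspace V" "subspace W" "W \<subseteq> V"
  shows "coeff (\<Sum>L\<in>intermediate W V. monom 1 (dim L - dim W)) i =
    int (card {L \<in> intermediate W V. dim L = dim W + i})"
proof -
  \<comment> \<open>This makes the truncated exponent \<open>dim L - dim W\<close> a true
    difference.\<close>
  have ge: "dim W \<le> dim L" if "L \<in> intermediate W V" for L
    using that assms by (intro dim_mono) (auto simp: intermediate_def intro: finite_subset)
  have "coeff (\<Sum>L\<in>intermediate W V. monom 1 (dim L - dim W)) i =
      (\<Sum>L\<in>intermediate W V. if dim L = dim W + i then 1 else 0 :: int)"
    unfolding coeff_sum coeff_monom
  proof (rule sum.cong)
    fix L assume "L \<in> intermediate W V"
    from ge[OF this] show "(if dim L - dim W = i then 1 else 0) = (if dim L = dim W + i then 1 else 0 :: int)"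
      by auto
  qed simp
  then show ?thesis using assms by (simp add: sum.If_cases Int_def)
qed

text \<open>The coefficients are Gaussian binomials, so palindromicity is their symmetry.\<close>

lemma palindromic_intermediate:
  assumes "finite V" "subspace V" "subspace W" "W \<subseteq> V"
  shows "palindromic (dim V - dim W) (\<Sum>L\<in>intermediate W V. monom (1::int) (dim L - dim W))"
  unfolding palindromic_def
proof (intro conjI allI impI)
  show "degree (\<Sum>L\<in>intermediate W V. monom (1::int) (dim L - dim W)) \<le> dim V - dim W"
  proof (rule degree_sum_le)
    fix L assume "L \<in> intermediate W V"
    then have "dim L \<le> dim V"
      using assms by (intro dim_mono) (auto simp: intermediate_def)
    then show "degree (monom (1::int) (dim L - dim W)) \<le> dim V - dim W"
      by (intro order_trans[OF degree_monom_le]) simp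
  qed (use assms in simp)
  fix i assume "i \<le> dim V - dim W"
  then have "gaussian_binomial CARD('f) (dim V - dim W) i =
      gaussian_binomial CARD('f) (dim V - dim W) (dim V - dim W - i)"
    using two_le_card_field by (rule gaussian_binomial_symmetric)
  then show "coeff (\<Sum>L\<in>intermediate W V. monom (1::int) (dim L - dim W)) i =
      coeff (\<Sum>L\<in>intermediate W V. monom (1::int) (dim L - dim W)) (dim V - dim W - i)"
    \<comment> \<open>Unfolding also rewrites the chained fact: the rational identity and the
      integer goal become the same equation between cardinalities.\<close>
    unfolding coeff_sum_intermediate[OF assms] of_nat_eq_iff
      card_intermediate[OF assms, symmetric] by simp
qed

end

section \<open>Deleting a small set of points from a vector space\<close>

text \<open>The ground set of the matroid is an arbitrary set \<open>E\<close> of labels for the vectors in \<open>V - X\<close>;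
  proportional vectors become parallel elements.\<close>

locale point_deletion = finite_field_vector_space scale
  for scale :: "'f::{field,finite} \<Rightarrow> 'b::ab_group_add \<Rightarrow> 'b" +
  fixes V X :: "'b set" and E :: "'a set" and v :: "'a \<Rightarrow> 'b" and d :: nat
  assumes finite_V: "finite V" and subspace_V: "subspace V"
    and zero_X: "0 \<in> X" and finite_X: "finite X"
    and bij_v: "bij_betw v E (V - X)"
    and card_X: "2 * card X < CARD('f) ^ d" and d_le: "2 * d \<le> dim V"
begin

text \<open>Independence of the image set agrees with that of the family, as \<open>v\<close> is
  injective on \<open>E\<close>.\<close>

definition M :: "'a matroid" where
  "M = \<lparr>ground = E, indeps = {I. I \<subseteq> E \<and> independent (v ` I)}\<rparr>"

lemma ground_M [simp]: "ground M = E"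
  and indeps_M: "indeps M = {I. I \<subseteq> E \<and> independent (v ` I)}"
  by (simp_all add: M_def)

lemma finite_E: "finite E"
  using bij_betw_finite[OF bij_v] finite_V by simp

lemma card_image_v: "A \<subseteq> E \<Longrightarrow> card (v ` A) = card A"
  using bij_v by (intro card_image) (auto simp: bij_betw_def intro: inj_on_subset)

lemma v_V: "A \<subseteq> E \<Longrightarrow> v ` A \<subseteq> V"
  using bij_v by (auto simp: bij_betw_def)

sublocale loopless_matroid M
proof
  fix I J assume IJ: "I \<in> indeps M" "J \<in> indeps M" "card I < card J"
  then have sub: "I \<subseteq> E" "J \<subseteq> E" "finite I"
    using finite_E by (auto simp: indeps_M intro: finite_subset)
  \<comment> \<open>Otherwise Steinitz exchange would bound \<open>card J\<close> by
    \<open>card I\<close>.\<close>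
  have "\<not> v ` J \<subseteq> span (v ` I)"
  proof
    assume "v ` J \<subseteq> span (v ` I)"
    then have "card (v ` J) \<le> card (v ` I)"
      using independent_span_bound[of "v ` I" "v ` J"] IJ(2) sub by (auto simp: indeps_M)
    then show False using IJ(3) sub by (simp add: card_image_v)
  qed
  then obtain e where e: "e \<in> J" "v e \<notin> span (v ` I)" by blast
  then have "e \<notin> I" by (auto intro: span_base)
  moreover have "insert e I \<in> indeps M"
    using IJ e sub independent_insertI[OF e(2)] by (auto simp: indeps_M)
  ultimately show "\<exists>e\<in>J - I. insert e I \<in> indeps M" using e by blast
next
  fix e assume "e \<in> ground M"
  \<comment> \<open>As \<open>0 \<in> X\<close>, no label in \<open>E\<close> is sent to the zero
    vector.\<close>
  then have "v e \<noteq> 0" using bij_v zero_X by (auto simp: bij_betw_def)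
  then show "{e} \<in> indeps M" using \<open>e \<in> ground M\<close> by (simp add: indeps_M)
next
  fix I J assume "J \<in> indeps M" "I \<subseteq> J"
  then show "I \<in> indeps M" using independent_mono[of "v ` J" "v ` I"] by (auto simp: indeps_M)
qed (use finite_E independent_empty in \<open>auto simp: indeps_M\<close>)

lemma rk_M:
  assumes "A \<subseteq> E"
  shows "rk M A = dim (v ` A)"
proof (rule antisym)
  have finA: "finite (v ` A)" using assms finite_E by (auto intro: finite_subset)
  obtain I where I: "I \<in> indeps M" "I \<subseteq> A" "card I = rk M A" by (rule obtain_basis)
  then have "dim (v ` I) = card I" by (simp add: indeps_M dim_eq_card_independent card_image_v)
  then show "rk M A \<le> dim (v ` A)" using I finA dim_mono[of "v ` I" "v ` A"] by auto
  obtain B where B: "B \<subseteq> v ` A" "independent B" "v ` A \<subseteq> span B" "card B = dim (v ` A)"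
    by (rule basis_exists)
  then obtain I where "I \<subseteq> A" "B = v ` I" by (meson subset_imageE)
  then show "dim (v ` A) \<le> rk M A"
    using B assms card_le_rk[of I A] by (auto simp: indeps_M card_image_v)
qed

section \<open>Flats of \<open>M\<close> as traces of subspaces\<close>

lemma flats_iff: "F \<in> flats M \<longleftrightarrow> F \<subseteq> E \<and> (\<forall>e\<in>E - F. v e \<notin> span (v ` F))"
proof -
  have "rk M F < rk M (insert e F) \<longleftrightarrow> v e \<notin> span (v ` F)" if "F \<subseteq> E" "e \<in> E - F" for e
  proof (cases "v e \<in> span (v ` F)")
    case True
    then have "dim (insert (v e) (v ` F)) = dim (v ` F)"
      by (intro span_eq_dim) (rule span_redundant)
    then show ?thesis using True that by (simp add: rk_M)
  next
    case False
    have "finite (v ` F)" using that finite_E by (auto intro: finite_subset)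
    then show ?thesis using dim_span_insert[OF _ False] that False by (simp add: rk_M)
  qed
  then show ?thesis by (auto simp: flats_def)
qed

text \<open>For a subspace \<open>L\<close> of \<open>V\<close> this is \<open>L - X\<close>, pulled
  back to labels along \<open>v\<close>.\<close>

definition trace :: "'b set \<Rightarrow> 'a set" where
  "trace L = {e \<in> E. v e \<in> L}"

lemma trace_flat: "subspace L \<Longrightarrow> trace L \<in> flats M"
  using span_minimal[of "v ` trace L" L] by (auto simp: flats_iff trace_def)

text \<open>The Galois connection between spanning and taking traces; it turns the flats above
  \<open>F\<close> into an interval of subspaces.\<close>

lemma subset_trace_iff:
  assumes "subspace L" "F \<subseteq> E"
  shows "F \<subseteq> trace L \<longleftrightarrow> span (v ` F) \<subseteq> L"
proof
  show "span (v ` F) \<subseteq> L" if "F \<subseteq> trace L"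
    using that assms by (intro span_minimal) (auto simp: trace_def)
  show "F \<subseteq> trace L" if "span (v ` F) \<subseteq> L"
    using that assms span_superset[of "v ` F"] by (auto simp: trace_def)
qed

text \<open>All of \<open>L\<close> outside the span of \<open>L - X\<close> lies in \<open>X\<close>, and this is at least half of \<open>L\<close>.\<close>

lemma dim_less_if_not_spanned:
  assumes L: "L \<in> intermediate {0} V" and ne: "span (v ` trace L) \<noteq> L"
  shows "dim L < d"
proof -
  let ?W = "span (v ` trace L)"
  have L': "subspace L" "L \<subseteq> V" "finite L"
    using L finite_V by (auto simp: intermediate_def intro: finite_subset)
  have WL: "?W \<subseteq> L" using L' by (intro span_minimal) (auto simp: trace_def)
  then have finW: "finite ?W" using L' by (auto intro: finite_subset)
  \<comment> \<open>A proper inclusion of subspaces multiplies the cardinality by at least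
    \<open>CARD('f)\<close>, hence at least doubles it.\<close>
  have "\<not> dim L \<le> dim ?W" using subspace_eqI[OF _ L'(1) WL L'(3)] ne by blast
  then have "CARD('f) ^ Suc (dim ?W) \<le> CARD('f) ^ dim L"
    using two_le_card_field by (intro power_increasing) auto
  moreover have "2 * CARD('f) ^ dim ?W \<le> CARD('f) ^ Suc (dim ?W)"
    using two_le_card_field by simp
  ultimately have half: "2 * card ?W \<le> card L"
    using L' finW by (simp only: card_subspace subspace_span)
  have "L - ?W \<subseteq> X"
  proof
    fix x assume x: "x \<in> L - ?W"
    show "x \<in> X"
    proof (rule ccontr)
      assume "x \<notin> X"
      then obtain e where "e \<in> E" "x = v e" using x L' bij_v by (auto simp: bij_betw_def)
      then have "x \<in> ?W" using x by (auto simp: trace_def intro!: span_base)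
      then show False using x by blast
    qed
  qed
  then have "card (L - ?W) \<le> card X" using finite_X by (rule card_mono[rotated])
  moreover have "card L = card ?W + card (L - ?W)"
    using WL L' finW by (simp add: card_Diff_subset card_mono)
  \<comment> \<open>The part outside \<open>?W\<close> is at least half of \<open>L\<close> and has
    at most \<open>card X\<close> elements, so \<open>card L\<close> is at most
    \<open>2 * card X\<close>.\<close>
  ultimately have "card L < CARD('f) ^ d" using half card_X by linarith
  then have "CARD('f) ^ dim L < CARD('f) ^ d" using card_subspace[OF L'(1,3)] by simp
  then show ?thesis using two_le_card_field by (subst (asm) power_strict_increasing_iff) auto
qed

section \<open>The rank of \<open>M\<close> and its Kazhdan--Lusztig polynomial\<close>

lemma V_intermediate: "V \<in> intermediate {0} V"
  using subspace_V by (simp add: intermediate_def subspace_0)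

lemma d_pos: "0 < d"
proof (rule ccontr)
  assume "\<not> 0 < d"
  then have "card X = 0" using card_X by simp
  then show False using zero_X finite_X by auto
qed

text \<open>If \<open>V - X\<close> did not span, then \<open>V\<close> itself would have dimension
  below \<open>d\<close>, against \<open>2 * d \<le> dim V\<close>.\<close>

lemma span_E: "span (v ` E) = V"
proof -
  have "trace V = E" using v_V[of E] by (auto simp: trace_def)
  then show ?thesis
    using dim_less_if_not_spanned[OF V_intermediate] d_le d_pos by auto
qed

lemma rank_M: "matroid_rank M = dim V"
  using rk_M[of E] span_E dim_span[of "v ` E"] by simp

text \<open>The candidate for \<open>kl_poly (contract M F)\<close>.\<close>

definition Q :: "'a set \<Rightarrow> int poly" where
  "Q F = (\<Sum>L | L \<in> intermediate {0} V \<and> trace L = F. monom 1 (dim L - rk M F))"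

text \<open>The monomial in front changes the grading of \<open>Q G\<close> from
  \<open>dim L - rk M G\<close> to \<open>dim L - rk M F\<close>. The fibres of \<open>trace\<close>
  over the flats above \<open>F\<close> then combine to all subspaces containing the span of
  \<open>F\<close>.\<close>

lemma sum_Q:
  assumes F: "F \<in> flats M"
  shows "(\<Sum>G | G \<in> flats M \<and> F \<subseteq> G. monom 1 (rk M G - rk M F) * Q G) =
    (\<Sum>L\<in>intermediate (span (v ` F)) V. monom 1 (dim L - dim (span (v ` F))))"
proof -
  let ?T = "{G \<in> flats M. F \<subseteq> G}" and ?S = "{L \<in> intermediate {0} V. F \<subseteq> trace L}"
  have FE: "F \<subseteq> E" using F by (simp add: flats_iff)
  have "(\<Sum>G\<in>?T. monom 1 (rk M G - rk M F) * Q G) =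
      (\<Sum>G\<in>?T. \<Sum>L | L \<in> ?S \<and> trace L = G. monom 1 (dim L - rk M F))"
  proof (rule sum.cong)
    fix G assume G: "G \<in> ?T"
    then have le: "rk M F \<le> rk M G" by (auto intro: rk_mono)
    \<comment> \<open>Together with \<open>le\<close>, this lets the truncated exponents add up to
      \<open>dim L - rk M F\<close>.\<close>
    have "rk M G \<le> dim L" if "L \<in> intermediate {0} V" "trace L = G" for L
    proof -
      have "finite L" using that finite_V by (auto simp: intermediate_def intro: finite_subset)
      moreover have "G \<subseteq> E" "v ` G \<subseteq> L" using that by (auto simp: trace_def)
      ultimately show ?thesis using rk_M[of G] dim_mono[of "v ` G" L] by simp
    qed
    then have "monom 1 (rk M G - rk M F) * Q G =
        (\<Sum>L | L \<in> intermediate {0} V \<and> trace L = G. monom 1 (dim L - rk M F))"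
      unfolding Q_def sum_distrib_left using le
      by (intro sum.cong) (auto simp: mult_monom)
    also have "{L. L \<in> intermediate {0} V \<and> trace L = G} = {L. L \<in> ?S \<and> trace L = G}"
      using G by auto
    finally show "monom 1 (rk M G - rk M F) * Q G =
      (\<Sum>L | L \<in> ?S \<and> trace L = G. monom 1 (dim L - rk M F))" .
  qed simp
  also have "\<dots> = (\<Sum>L\<in>?S. monom 1 (dim L - rk M F))"
    using finite_flats finite_V by (intro sum.group) (auto simp: trace_flat intermediate_def)
  also have "?S = intermediate (span (v ` F)) V"
    using subset_trace_iff[OF _ FE] by (auto simp: intermediate_def subspace_0)
  finally show ?thesis using rk_M[OF FE] by simp
qed

text \<open>\<open>Q\<close> satisfies the hypotheses of \<open>kl_poly_interval\<close>; the value
  at the flat \<open>{}\<close> is the claim, because a subspace of \<open>V\<close> has empty trace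
  exactly when it lies in \<open>X\<close>.\<close>

theorem kl_poly_M:
  "kl_poly M = (\<Sum>L | L \<in> intermediate {0} V \<and> L \<subseteq> X. monom 1 (dim L))"
proof -
  have "kl_poly (contract M {}) = Q {}"
  proof (rule kl_poly_interval)
    fix F assume F: "F \<in> flats M"
    then have FE: "F \<subseteq> E" by (simp add: flats_iff)
    let ?W = "span (v ` F)"
    have W: "?W \<subseteq> V" "subspace ?W" using span_minimal[OF v_V[OF FE] subspace_V] by simp_all
    have rkF: "rk M F = dim ?W" using rk_M[OF FE] by simp
    show "palindromic (matroid_rank M - rk M F)
        (\<Sum>G | G \<in> flats M \<and> F \<subseteq> G. monom 1 (rk M G - rk M F) * Q G)"
      unfolding sum_Q[OF F] unfolding rank_M rkF
      using finite_V subspace_V W by (intro palindromic_intermediate)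
    show "Q F = 1" if "rk M F = matroid_rank M"
    proof -
      \<comment> \<open>At full rank the only subspace with trace \<open>F\<close> is
        \<open>V\<close>, and it contributes exponent 0.\<close>
      have WV: "?W = V"
        using that W subspace_V finite_V rkF rank_M by (intro subspace_eqI) simp_all
      then have "F = E" using F v_V[of E] by (auto simp: flats_iff)
      have "L = V" if "L \<in> intermediate {0} V" "trace L = F" for L
        using that subset_trace_iff[of L F] FE WV by (auto simp: intermediate_def)
      moreover have "trace V = F" using v_V[of E] \<open>F = E\<close> by (auto simp: trace_def)
      ultimately have "{L. L \<in> intermediate {0} V \<and> trace L = F} = {V}"
        using V_intermediate by auto
      then show ?thesis by (simp add: Q_def rkF WV)
    qed
    assume lt: "rk M F < matroid_rank M"
    have "degree (Q F) \<le> (dim V - rk M F - 1) div 2"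
      unfolding Q_def
    proof (rule degree_sum_le)
      fix L assume L: "L \<in> {L. L \<in> intermediate {0} V \<and> trace L = F}"
      \<comment> \<open>A subspace spanned by its trace has exponent 0; any other has dimension
        below \<open>d\<close>, at most half of \<open>dim V\<close>.\<close>
      have "2 * (dim L - rk M F) < dim V - rk M F"
      proof (cases "?W = L")
        case True
        then have "rk M F = dim L" using rkF by simp
        then show ?thesis using lt rank_M by simp
      next
        case False
        then have "dim L < d" using L dim_less_if_not_spanned[of L] by auto
        then show ?thesis using d_le lt rank_M by linarith
      qed
      then show "degree (monom (1::int) (dim L - rk M F)) \<le> (dim V - rk M F - 1) div 2"
        by (intro order_trans[OF degree_monom_le]) linarith
    qed (use finite_V in simp)
    then show "2 * degree (Q F) < matroid_rank M - rk M F"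
      using lt unfolding rank_M by linarith
  qed (rule empty_flat)
  moreover have "trace L = {} \<longleftrightarrow> L \<subseteq> X" if "L \<in> intermediate {0} V" for L
  proof -
    have "trace L = {} \<longleftrightarrow> v ` E \<inter> L = {}" by (auto simp: trace_def)
    also have "v ` E = V - X" using bij_v by (simp add: bij_betw_def)
    finally show ?thesis using that by (auto simp: intermediate_def)
  qed
  ultimately show ?thesis by (simp add: Q_def cong: conj_cong)
qed

end

section \<open>Coordinate subspaces\<close>

text \<open>All functions on \<open>nat\<close> form one ambient space of infinite dimension; the
  spaces \<open>GF(q)^r\<close> for all \<open>r\<close> sit in it as coordinate subspaces of a
  single type.\<close>

interpretation coords: finite_field_vector_space "\<lambda>(c :: 'f::{field,finite}) (f :: nat \<Rightarrow> 'f) i. c * f i"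
  by unfold_locales (auto simp: fun_eq_iff algebra_simps)

definition coord_subspace :: "nat set \<Rightarrow> (nat \<Rightarrow> 'f::{field,finite}) set" where
  "coord_subspace I = {f. \<forall>i. i \<notin> I \<longrightarrow> f i = 0}"

lemma subspace_coord_subspace: "coords.subspace (coord_subspace I :: (nat \<Rightarrow> 'f::{field,finite}) set)"
  by (auto simp: coords.subspace_def coord_subspace_def)

lemma card_coord_subspace:
  assumes "finite I"
  shows "card (coord_subspace I :: (nat \<Rightarrow> 'f::{field,finite}) set) = CARD('f) ^ card I"
proof -
  have "bij_betw (\<lambda>f. restrict f I) (coord_subspace I :: (nat \<Rightarrow> 'f) set) (I \<rightarrow>\<^sub>E UNIV)"
    \<comment> \<open>The inverse of restriction is extension by zero.\<close>
    by (rule bij_betw_byWitness[where f' = "\<lambda>g i. if i \<in> I then g i else 0"])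
      (auto simp: coord_subspace_def fun_eq_iff PiE_def extensional_def)
  then show ?thesis using assms by (simp add: bij_betw_same_card card_PiE)
qed

lemma finite_coord_subspace:
  "finite I \<Longrightarrow> finite (coord_subspace I :: (nat \<Rightarrow> 'f::{field,finite}) set)"
  by (rule card_ge_0_finite) (simp add: card_coord_subspace zero_less_card_finite)

lemma dim_coord_subspace:
  assumes "finite I"
  shows "coords.dim (coord_subspace I :: (nat \<Rightarrow> 'f::{field,finite}) set) = card I"
proof -
  have "CARD('f) ^ coords.dim (coord_subspace I :: (nat \<Rightarrow> 'f) set) = CARD('f) ^ card I"
    using coords.card_subspace[OF subspace_coord_subspace finite_coord_subspace[OF assms]]
      card_coord_subspace[OF assms] by metis
  then show ?thesis using coords.two_le_card_field[where 'f='f] by (subst (asm) power_inject_exp) auto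
qed

lemma coord_subspace_mono: "I \<subseteq> J \<Longrightarrow> coord_subspace I \<subseteq> coord_subspace J"
  by (auto simp: coord_subspace_def)

text \<open>Let \<open>f\<close> in \<open>L\<close> lie outside the first piece, hence on an axis
  \<open>k + i\<close>. A vector \<open>g\<close> of \<open>L\<close> off this axis would make
  \<open>f + g\<close> nonzero at \<open>k + i\<close> and at a second coordinate, so
  \<open>f + g\<close> would lie in no piece. Thus \<open>L\<close> is contained in the axis, and it
  contains all multiples of \<open>f\<close>.\<close>

lemma subspaces_of_coord_union:
  assumes "coords.subspace L" and L: "L \<subseteq> coord_subspace {..<k} \<union> (\<Union>i<s. coord_subspace {k + i})"
  shows "L \<subseteq> coord_subspace {..<k} \<or> (\<exists>i<s. L = (coord_subspace {k + i} :: (nat \<Rightarrow> 'f::{field,finite}) set))"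
proof (cases "L \<subseteq> coord_subspace {..<k}")
  case False
  then obtain f where f: "f \<in> L" "f \<notin> coord_subspace {..<k}" by blast
  then obtain i where i: "i < s" "f \<in> coord_subspace {k + i}" using L by blast
  have fi: "f (k + i) \<noteq> 0" using f(2) i(2) by (auto simp: coord_subspace_def) metis
  have "g \<in> coord_subspace {k + i}" if g: "g \<in> L" for g
  proof (rule ccontr)
    assume "g \<notin> coord_subspace {k + i}"
    then obtain j where j: "j \<noteq> k + i" "g j \<noteq> 0" by (auto simp: coord_subspace_def)
    have "g \<in> coord_subspace {..<k} \<or> (\<exists>m<s. g \<in> coord_subspace {k + m})" using L g by blast
    \<comment> \<open>The nonzero entry at \<open>j\<close> places \<open>g\<close> in the first
      piece or on a different axis.\<close>
    then have "g (k + i) = 0" using j by (auto simp: coord_subspace_def) metis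
    then have nz: "(f + g) (k + i) \<noteq> 0" "(f + g) j \<noteq> 0"
      using i(2) fi j by (auto simp: coord_subspace_def)
    have "f + g \<in> L" using assms(1) f(1) g by (rule coords.subspace_add)
    then have "f + g \<in> coord_subspace {..<k} \<or> (\<exists>m<s. f + g \<in> coord_subspace {k + m})"
      using L by blast
    then show False
    proof
      assume "f + g \<in> coord_subspace {..<k}"
      then have "(f + g) (k + i) = 0" unfolding coord_subspace_def by blast
      then show False using nz by blast
    next
      assume "\<exists>m<s. f + g \<in> coord_subspace {k + m}"
      then obtain m where "\<forall>l. l \<noteq> k + m \<longrightarrow> (f + g) l = 0" unfolding coord_subspace_def by blast
      then have "k + i = k + m" "j = k + m" using nz by blast+
      then show False using j by simp
    qed
  qed
  moreover have "g \<in> L" if "g \<in> coord_subspace {k + i}" for g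
  proof -
    have "g = (\<lambda>j. (g (k + i) / f (k + i)) * f j)"
    proof
      show "g j = (g (k + i) / f (k + i)) * f j" for j
        using that i(2) fi by (cases "j = k + i") (auto simp: coord_subspace_def)
    qed
    then show ?thesis using coords.subspace_scale[OF assms(1) f(1)] by metis
  qed
  ultimately show ?thesis using i(1) by blast
qed simp

section \<open>Linear independence of coordinate families\<close>

lemma sum_fun_apply: "(\<Sum>x\<in>A. g x) i = (\<Sum>x\<in>A. g x i)"
  for g :: "'a \<Rightarrow> 'b \<Rightarrow> 'c::comm_monoid_add"
  by (induction A rule: infinite_finite_induct) auto

text \<open>Injectivity matches coefficients on labels with coefficients on vectors, and all entries
  from \<open>n\<close> on vanish, so the first \<open>n\<close> equations suffice.\<close>

lemma lin_indep_family_iff_independent: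
  assumes "finite S" "inj_on v S" "v ` S \<subseteq> coord_subspace {..<n}"
  shows "lin_indep_family n v S \<longleftrightarrow> coords.independent (v ` S)"
proof -
  have sum: "(\<Sum>x\<in>v ` S. (\<lambda>i. u x * x i)) = 0 \<longleftrightarrow> (\<forall>i<n. (\<Sum>e\<in>S. u (v e) * v e i) = 0)" for u
  proof -
    have "(\<Sum>x\<in>v ` S. (\<lambda>i. u x * x i)) i = (\<Sum>e\<in>S. u (v e) * v e i)" for i
      using assms(2) by (simp add: sum_fun_apply sum.reindex)
    moreover have "(\<Sum>e\<in>S. u (v e) * v e i) = 0" if "\<not> i < n" for i
      using assms(3) that by (intro sum.neutral) (auto simp: coord_subspace_def)
    ultimately show ?thesis by (auto simp: fun_eq_iff)
  qed
  show ?thesis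
  proof
    assume indep: "lin_indep_family n v S"
    show "coords.independent (v ` S)"
    proof (rule coords.independent_if_scalars_zero)
      fix u x assume "(\<Sum>x\<in>v ` S. (\<lambda>i. u x * x i)) = 0" "x \<in> v ` S"
      then show "u x = 0"
        using indep[unfolded lin_indep_family_def, rule_format, of "\<lambda>e. u (v e)"] sum by auto
    qed (use assms in simp)
  next
    assume indep: "coords.independent (v ` S)"
    show "lin_indep_family n v S"
      unfolding lin_indep_family_def
    proof (intro allI impI ballI)
      fix c e assume c: "\<forall>i<n. (\<Sum>e\<in>S. c e * v e i) = 0" and e: "e \<in> S"
      define u where "u x = c (the_inv_into S v x)" for x
      have u: "u (v e) = c e" if "e \<in> S" for e
        using that assms(2) by (simp add: u_def the_inv_into_f_f)
      then have "(\<Sum>x\<in>v ` S. (\<lambda>i. u x * x i)) = 0" using c unfolding sum by simp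
      then have "u (v e) = 0"
        using coords.independentD[OF indep, of "v ` S" u "v e"] assms(1) e by simp
      then show "c e = 0" using u[OF e] by simp
    qed
  qed
qed

section \<open>The matroid for given \<open>q\<close>, \<open>k\<close> and \<open>s\<close>\<close>

theorem corollary1p2:
  fixes q k s :: nat
  assumes "primepow q"
    and "CARD('f::{field,finite}) = q"
  shows "\<exists>r0. \<forall>r\<ge>r0. \<exists>M :: nat matroid.
    loopless_matroid M \<and>
    representable_over TYPE('f) M \<and>
    matroid_rank M = r \<and>
    map_poly of_int (kl_poly M) =
      (\<Sum>j\<le>k. monom (gaussian_binomial q k j) j) + monom (of_nat s) 1"
proof -
  \<comment> \<open>\<open>X\<close> will have at most \<open>q ^ k + s * q\<close> elements, so
    \<open>2 * card X \<le> d < 2 ^ d \<le> q ^ d\<close>. The threshold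
    \<open>k + s + 2 * d\<close> for \<open>r\<close> leaves room for the coordinates used by
    \<open>X\<close> and gives \<open>2 * d \<le> r\<close>.\<close>
  define d where "d = 2 * (q ^ k + s * q)"
  have "\<exists>M :: nat matroid. loopless_matroid M \<and> representable_over TYPE('f) M \<and>
      matroid_rank M = r \<and> map_poly of_int (kl_poly M) =
        (\<Sum>j\<le>k. monom (gaussian_binomial q k j) j) + monom (of_nat s) 1"
    if r: "k + s + 2 * d \<le> r" for r
  proof -
    define U :: "(nat \<Rightarrow> 'f) set" where "U = coord_subspace {..<k}"
    define P :: "nat \<Rightarrow> (nat \<Rightarrow> 'f) set" where "P i = coord_subspace {k + i}" for i
    define V :: "(nat \<Rightarrow> 'f) set" where "V = coord_subspace {..<r}"
    define X where "X = U \<union> (\<Union>i<s. P i)"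
    note subspace_coord_subspace [where 'f='f, simp]
    have V: "finite V" "coords.subspace V" "coords.dim V = r"
      by (simp_all add: V_def finite_coord_subspace dim_coord_subspace)
    have U: "finite U" "coords.subspace U" "coords.dim U = k" "0 \<in> U" "card U = q ^ k"
      using assms(2) by (simp_all add: U_def finite_coord_subspace dim_coord_subspace card_coord_subspace)
        (simp add: coord_subspace_def)
    have P: "coords.subspace (P i)" "coords.dim (P i) = 1" "card (P i) = q" "finite (P i)" for i
      using assms(2) by (simp_all add: P_def finite_coord_subspace dim_coord_subspace card_coord_subspace)
    have UV: "U \<subseteq> V" using r unfolding U_def V_def by (intro coord_subspace_mono) auto
    have PV: "P i \<subseteq> V" if "i < s" for i
      using r that unfolding P_def V_def by (intro coord_subspace_mono) auto
    \<comment> \<open>These unit vectors witness that the axes are distinct and not contained in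
      \<open>U\<close>.\<close>
    define e :: "nat \<Rightarrow> nat \<Rightarrow> 'f" where "e i = (\<lambda>j. if j = k + i then 1 else 0)" for i
    have e: "e i \<in> P j \<longleftrightarrow> i = j" "e i \<notin> U" for i j
      by (auto simp: e_def P_def U_def coord_subspace_def)
    have "card (\<Union>i<s. P i) \<le> s * q" using card_UN_le[of "{..<s}" P] by (simp add: P)
    then have "card X \<le> q ^ k + s * q"
      unfolding X_def using card_Un_le[of U "\<Union>i<s. P i"] U by simp
    then have "2 * card X \<le> d" by (simp add: d_def)
    also have "d < 2 ^ d" by simp
    also have "2 ^ d \<le> CARD('f) ^ d" using coords.two_le_card_field[where 'f='f] by (rule power_mono) simp
    finally have card_X: "2 * card X < CARD('f) ^ d" .
    obtain v where v: "bij_betw v {..<card (V - X)} (V - X)"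
      using ex_bij_betw_nat_finite[of "V - X"] V by (auto simp: atLeast0LessThan)
    interpret point_deletion "\<lambda>(c :: 'f) f i. c * f i" V X "{..<card (V - X)}" v d
      by unfold_locales (use V U P card_X v r in \<open>auto simp: X_def\<close>)
    have "representable_over TYPE('f) M"
      unfolding representable_over_def
    proof (intro exI[of _ r] exI[of _ v] allI impI)
      fix S assume "S \<subseteq> ground M"
      then have S: "S \<subseteq> {..<card (V - X)}" by simp
      then have "finite S" "inj_on v S" "v ` S \<subseteq> V"
        using v v_V[OF S] by (auto simp: bij_betw_def intro: finite_subset inj_on_subset)
      then have "lin_indep_family r v S \<longleftrightarrow> coords.independent (v ` S)"
        unfolding V_def by (rule lin_indep_family_iff_independent)
      then show "S \<in> indeps M \<longleftrightarrow> lin_indep_family r v S"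
        using S by (simp add: indeps_M)
    qed
    moreover have "map_poly of_int (kl_poly M) =
        (\<Sum>j\<le>k. monom (gaussian_binomial q k j) j) + monom (of_nat s) 1"
    proof (rule poly_eqI)
      fix i
      let ?I = "coords.intermediate {0} U"
      have dim0: "coords.dim {0 :: nat \<Rightarrow> 'f} = 0"
        by (rule coords.dim_unique[of "{}"]) (simp_all add: coords.independent_empty)
      have notin: "P i \<notin> ?I" for i
        using e(1)[of i i] e(2)[of i] by (auto simp: coords.intermediate_def)
      have inj: "inj_on P {..<s}"
        by (rule inj_onI) (use e(1) in metis)
      \<comment> \<open>A subspace inside \<open>X\<close> lies in \<open>U\<close> or is one of the
        axes; the former give the Gaussian binomials, the latter the summand
        \<open>s t\<close>.\<close>
      have "{L. L \<in> coords.intermediate {0} V \<and> L \<subseteq> X} = ?I \<union> P ` {..<s}"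
      proof (intro equalityI subsetI)
        fix L assume "L \<in> {L. L \<in> coords.intermediate {0} V \<and> L \<subseteq> X}"
        then have "coords.subspace L" "0 \<in> L" "L \<subseteq> X" by (auto simp: coords.intermediate_def)
        then show "L \<in> ?I \<union> P ` {..<s}"
          using subspaces_of_coord_union[of L k s]
          by (auto simp: coords.intermediate_def X_def U_def P_def)
      next
        fix L assume "L \<in> ?I \<union> P ` {..<s}"
        then show "L \<in> {L. L \<in> coords.intermediate {0} V \<and> L \<subseteq> X}"
          using UV PV P(1) coords.subspace_0[OF P(1)]
          by (auto simp: coords.intermediate_def X_def)
      qed
      then have "kl_poly M = (\<Sum>L\<in>?I. monom 1 (coords.dim L)) + (\<Sum>L\<in>P ` {..<s}. monom 1 (coords.dim L))"
        unfolding kl_poly_M using U(1) notin by (simp only:) (intro sum.union_disjoint, auto)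
      also have "(\<Sum>L\<in>P ` {..<s}. monom 1 (coords.dim L)) = (of_nat s * monom 1 1 :: int poly)"
        using inj by (simp add: sum.reindex P)
      finally have kl: "kl_poly M = (\<Sum>L\<in>?I. monom 1 (coords.dim L)) + of_nat s * monom 1 1" .
      have "coeff (\<Sum>L\<in>?I. monom 1 (coords.dim L)) i = int (card {L \<in> ?I. coords.dim L = i})"
        using U coords.coeff_sum_intermediate[of U "{0}" i] by (simp add: dim0)
      moreover have "coeff (of_nat s * monom 1 1 :: int poly) i = (if i = 1 then int s else 0)"
        by (simp add: of_nat_poly)
      ultimately have "coeff (kl_poly M) i =
          int (card {L \<in> ?I. coords.dim L = i}) + (if i = 1 then int s else 0)"
        unfolding kl coeff_add by (simp only:)
      moreover have "of_nat (card {L \<in> ?I. coords.dim L = i}) = gaussian_binomial q k i"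
        using U coords.card_intermediate[of U "{0}" i] assms(2) by (simp add: dim0)
      ultimately have "of_int (coeff (kl_poly M) i) = gaussian_binomial q k i + (if i = 1 then of_nat s else 0)"
        by simp
      \<comment> \<open>Above degree \<open>k\<close> the sum has no term, which agrees with the
        vanishing of the Gaussian binomial there.\<close>
      then show "coeff (map_poly of_int (kl_poly M)) i =
          coeff ((\<Sum>j\<le>k. monom (gaussian_binomial q k j) j) + monom (of_nat s) 1) i"
        by (auto simp: coeff_map_poly coeff_sum gaussian_binomial_eq_0)
    qed
    ultimately show ?thesis using loopless_matroid_axioms rank_M V(3) by blast
  qed
  then show ?thesis by blast
qed

end
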